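(* Let $b_0,b_1,c\in\mathbb{Z}$ with $b_1\neq0$, let $\varepsilon\in\{1,-1\}$, and let ${\bf a}=(a_n)_{n\in\mathbb{N}}$ be given by $a_0=c$, $a_n=(b_1n+b_0)a_{n-1}+\varepsilon^n c$ for $n>0$. Then the set $\mathcal{P}_{\bf a}$ is infinite.
   Context: $\mathbb{N}=\{0,1,2,\dots\}$. For a sequence of integers ${\bf a}=(a_n)_{n\in\mathbb{N}}$, $\mathcal{P}_{\bf a}$ is the set of all prime numbers $p$ such that $p\mid a_n$ for some $n\in\mathbb{N}$. *)

theory Defs
  imports Complex_Main "HOL-Computational_Algebra.Primes"
begin

definition prime_divisors_of_seq :: "(nat \<Rightarrow> int) \<Rightarrow> nat set" where
  "prime_divisors_of_seq a = {p. prime p \<and> (\<exists>n. int p dvd a n)}"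

end

theory Submission
  imports Defs "HOL-Number_Theory.Cong"
begin

text \<open>
  Modulo every \<open>m\<close> the sequence is eventually periodic, because the coefficients of the recurrence
  are periodic modulo \<open>m\<close>. Call \<open>N\<close> bad for a prime \<open>p\<close> if \<open>0\<close> is a \<open>p\<close>-adic limit point of \<open>a n\<close> as
  \<open>n \<rightarrow> \<infinity>\<close> and \<open>n \<rightarrow> N\<close> in the profinite topology. If \<open>N\<close> and \<open>N + k\<close> are both bad,
  then running the recurrence from the value \<open>0\<close> at \<open>N\<close> yields after \<open>k\<close> steps an integer that is
  divisible by all powers of \<open>p\<close>, hence \<open>0\<close>; for large \<open>N\<close> this contradicts the growth of
  the recurrence. So each prime has only finitely many bad \<open>N\<close>. If only finitely many primes divided
  the sequence, some \<open>N\<close> would be bad for none of them, and along a suitable progression through \<open>N\<close>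
  the valuations of \<open>a n\<close> at all these primes would stay bounded. Then \<open>a n\<close> is bounded along
  this progression, contradicting \<open>\<bar>a n\<bar> \<rightarrow> \<infinity>\<close>.
\<close>

text \<open>The starting value \<open>y\<close> at index \<open>N\<close> is a free parameter, so
  that \<open>0\<close> can replace the true term \<open>a N\<close>.\<close>

fun affine_iter :: "(nat \<Rightarrow> int) \<Rightarrow> (nat \<Rightarrow> int) \<Rightarrow> nat \<Rightarrow> int \<Rightarrow> nat \<Rightarrow> int" where
  "affine_iter f u N y 0 = y"
| "affine_iter f u N y (Suc k) = f (N + k) * affine_iter f u N y k + u (N + k)"

lemma affine_iter_shift:
  "affine_iter f u N y (Suc k) = affine_iter f u (Suc N) (f N * y + u N) k"
  by (induction k) auto

lemma affine_iter_seq: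
  assumes "\<And>n. a (Suc n) = f n * a n + u n"
  shows "affine_iter f u N (a N) k = a (N + k)"
  by (induction k) (auto simp: assms)

lemma affine_iter_cong:
  assumes "\<And>i. [f (N + i) = f (N' + i)] (mod m)" "\<And>i. [u (N + i) = u (N' + i)] (mod m)"
    and "[y = y'] (mod m)"
  shows "[affine_iter f u N y k = affine_iter f u N' y' k] (mod m)"
  by (induction k) (auto intro!: cong_add cong_mult assms)

text \<open>A nonzero integer \<open>x\<close> at least doubles in absolute value: |f x + u| \<ge>
  (|u| + 2)|x| - |u| \<ge> 2|x|, as |x| \<ge> 1.\<close>

lemma affine_iter_growth:
  assumes "\<And>n. n \<ge> N \<Longrightarrow> \<bar>f n\<bar> \<ge> \<bar>u n\<bar> + 2" and "y \<noteq> 0"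
  shows "\<bar>affine_iter f u N y k\<bar> \<ge> int k + 1"
proof (induction k)
  case 0
  then show ?case using assms(2) by simp
next
  case (Suc k)
  let ?x = "affine_iter f u N y k" and ?f = "f (N + k)" and ?u = "u (N + k)"
  have "(\<bar>?u\<bar> + 2) * \<bar>?x\<bar> \<le> \<bar>?f\<bar> * \<bar>?x\<bar>"
    using assms(1) by (intro mult_right_mono) auto
  moreover have "\<bar>?u\<bar> * 1 \<le> \<bar>?u\<bar> * \<bar>?x\<bar>"
    using Suc by (intro mult_left_mono) auto
  ultimately have "\<bar>?u\<bar> + 2 * \<bar>?x\<bar> \<le> \<bar>?f * ?x\<bar>"
    by (simp add: abs_mult algebra_simps)
  then show ?case using Suc by simp
qed

text \<open>One step from \<open>0\<close> leads to \<open>u N\<close>, which is nonzero, and from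
  there the growth bound applies.\<close>

lemma affine_iter_0_nonzero:
  assumes "\<And>n. n \<ge> N \<Longrightarrow> \<bar>f n\<bar> \<ge> \<bar>u n\<bar> + 2" and "u N \<noteq> 0" and "k > 0"
  shows "affine_iter f u N 0 k \<noteq> 0"
proof -
  obtain l where l: "k = Suc l" using assms(3) gr0_conv_Suc by blast
  have "\<bar>affine_iter f u (Suc N) (u N) l\<bar> \<ge> int l + 1"
    using assms(1,2) by (intro affine_iter_growth) auto
  then show ?thesis unfolding l affine_iter_shift by auto
qed

definition residually_periodic :: "(nat \<Rightarrow> int) \<Rightarrow> bool" where
  "residually_periodic f \<longleftrightarrow> (\<forall>m>0. \<exists>T>0. \<forall>n. [f (n + T) = f n] (mod m))"

lemma cong_add_mult_period:
  fixes f :: "nat \<Rightarrow> int"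
  assumes "\<And>n. n \<ge> n0 \<Longrightarrow> [f (n + T) = f n] (mod m)" and "n \<ge> n0"
  shows "[f (n + j * T) = f n] (mod m)"
proof (induction j)
  case (Suc j)
  have "[f (n + j * T + T) = f (n + j * T)] (mod m)"
    using assms by simp
  then show ?case using Suc by (metis add.assoc add.commute cong_trans mult_Suc)
qed simp

text \<open>Pigeonhole on the terms at multiples of \<open>P * Q\<close>, a common period of the
  coefficients: two of them agree modulo \<open>m\<close>, and the same coefficients follow both, so
  all later terms agree too.\<close>

lemma affine_recurrence_eventually_periodic:
  assumes rec: "\<And>n. a (Suc n) = f n * a n + u n"
    and f: "residually_periodic f" and u: "residually_periodic u" and m: "m > 0"
  obtains T n0 where "T > 0" "\<And>n. [f (n + T) = f n] (mod m)" "\<And>n. [u (n + T) = u n] (mod m)"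
    "\<And>n. n \<ge> n0 \<Longrightarrow> [a (n + T) = a n] (mod m)"
proof -
  obtain P where P: "P > 0" "\<And>n. [f (n + P) = f n] (mod m)"
    using f m unfolding residually_periodic_def by blast
  obtain Q where Q: "Q > 0" "\<And>n. [u (n + Q) = u n] (mod m)"
    using u m unfolding residually_periodic_def by blast
  have "finite ((\<lambda>i. a (i * (P * Q)) mod m) ` UNIV)"
    by (rule finite_subset[of _ "{0..<m}"]) (use m in auto)
  then have "\<not> inj (\<lambda>i. a (i * (P * Q)) mod m)"
    using finite_imageD infinite_UNIV_nat by blast
  then obtain i j where ij: "i < j" "[a (j * (P * Q)) = a (i * (P * Q))] (mod m)"
    unfolding inj_def cong_def by (metis nat_neq_iff)
  define n0 T where "n0 = i * (P * Q)" and "T = (j - i) * (P * Q)"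
  have n0T: "n0 + T = j * (P * Q)"
    using ij(1) unfolding n0_def T_def by (metis add_mult_distrib le_add_diff_inverse less_imp_le)
  have T: "T > 0" using P Q ij(1) by (simp add: T_def)
  have fT: "[f (n + T) = f n] (mod m)" for n
    using cong_add_mult_period[of 0 f P m n "(j - i) * Q"] P(2) by (simp add: T_def mult_ac)
  have uT: "[u (n + T) = u n] (mod m)" for n
    using cong_add_mult_period[of 0 u Q m n "(j - i) * P"] Q(2) by (simp add: T_def mult_ac)
  have "[a (n + T) = a n] (mod m)" if "n \<ge> n0" for n
  proof -
    have "[f (n0 + T + l) = f (n0 + l)] (mod m)" "[u (n0 + T + l) = u (n0 + l)] (mod m)" for l
      using fT[of "n0 + l"] uT[of "n0 + l"] by (simp_all add: add_ac)
    then have "[affine_iter f u (n0 + T) (a (n0 + T)) (n - n0)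
              = affine_iter f u n0 (a n0) (n - n0)] (mod m)"
      using ij(2) n0T by (intro affine_iter_cong) (simp_all add: n0_def)
    then show ?thesis
      using that by (simp add: affine_iter_seq[of a f u, OF rec] add_ac)
  qed
  with T fT uT show ?thesis using that by blast
qed

text \<open>Here \<open>e\<close> measures p-adic closeness to 0, \<open>T\<close> profinite
  closeness to \<open>N\<close>, and \<open>n0\<close> closeness to infinity.\<close>

definition bad_index :: "(nat \<Rightarrow> int) \<Rightarrow> int \<Rightarrow> nat \<Rightarrow> bool" where
  "bad_index a p N \<longleftrightarrow> (\<forall>e T n0. T > 0 \<longrightarrow> (\<exists>j. N + j * T \<ge> n0 \<and> p ^ e dvd a (N + j * T)))"

lemma all_powers_dvd_imp_zero:
  fixes x p :: int
  assumes "p > 1" "\<And>e. p ^ e dvd x"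
  shows "x = 0"
proof (rule ccontr)
  assume "x \<noteq> 0"
  have "finite {e. p ^ e dvd x}"
    using \<open>x \<noteq> 0\<close> assms(1) by (intro finite_divisor_powers) auto
  then show False using assms(2) by simp
qed

lemma bad_index_unique:
  assumes rec: "\<And>n. a (Suc n) = f n * a n + u n"
    and f: "residually_periodic f" and u: "residually_periodic u"
    and growth: "\<And>n. n \<ge> N \<Longrightarrow> \<bar>f n\<bar> \<ge> \<bar>u n\<bar> + 2" and "u N \<noteq> 0"
    and "p > 1" and "k > 0" and bad: "bad_index a p N" "bad_index a p (N + k)"
  shows False
proof -
  have "p ^ e dvd affine_iter f u N 0 k" for e
  proof -
    have "p ^ e > 0" using \<open>p > 1\<close> by simp
    then obtain T n0 where T: "T > 0" "\<And>n. [f (n + T) = f n] (mod p ^ e)"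
        "\<And>n. [u (n + T) = u n] (mod p ^ e)" "\<And>n. n \<ge> n0 \<Longrightarrow> [a (n + T) = a n] (mod p ^ e)"
      using affine_recurrence_eventually_periodic[of a f u, OF rec f u] by metis
    obtain i where i: "N + i * T \<ge> n0" "p ^ e dvd a (N + i * T)"
      using bad(1) T(1) unfolding bad_index_def by blast
    obtain j where j: "N + k + j * T \<ge> n0" "p ^ e dvd a (N + k + j * T)"
      using bad(2) T(1) unfolding bad_index_def by blast
    \<comment> \<open>Adding both shifts puts \<open>M\<close> beyond \<open>N + i * T\<close> and
      \<open>M + k\<close> beyond \<open>N + k + j * T\<close> by multiples of \<open>T\<close>, so
      a single index inherits both divisibilities.\<close>
    define M where "M = N + (i + j) * T"
    have "[a M = a (N + i * T)] (mod p ^ e)"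
      using cong_add_mult_period[of n0 a T "p ^ e", OF T(4) i(1), of j]
      by (simp add: M_def algebra_simps)
    then have M: "[a M = 0] (mod p ^ e)" using i(2) by (meson cong_0_iff cong_trans)
    have "[a (M + k) = a (N + k + j * T)] (mod p ^ e)"
      using cong_add_mult_period[of n0 a T "p ^ e", OF T(4) j(1), of i]
      by (simp add: M_def algebra_simps)
    then have Mk: "[a (M + k) = 0] (mod p ^ e)" using j(2) by (meson cong_0_iff cong_trans)
    \<comment> \<open>The coefficients, unlike \<open>a\<close>, are periodic from index 0 on, so
      they can be moved back to \<open>N\<close>, which may lie below \<open>n0\<close>.\<close>
    have "[f (M + l) = f (N + l)] (mod p ^ e)" "[u (M + l) = u (N + l)] (mod p ^ e)" for l
      using cong_add_mult_period[of 0 f T "p ^ e" "N + l" "i + j"]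
        cong_add_mult_period[of 0 u T "p ^ e" "N + l" "i + j"] T(2,3)
      by (simp_all add: M_def algebra_simps)
    then have "[affine_iter f u M (a M) k = affine_iter f u N 0 k] (mod p ^ e)"
      using M by (intro affine_iter_cong)
    then show ?thesis
      using Mk by (metis affine_iter_seq[of a f u, OF rec] cong_0_iff cong_sym cong_trans)
  qed
  then have "affine_iter f u N 0 k = 0"
    using all_powers_dvd_imp_zero \<open>p > 1\<close> by blast
  moreover have "affine_iter f u N 0 k \<noteq> 0"
    using growth \<open>u N \<noteq> 0\<close> \<open>k > 0\<close> by (rule affine_iter_0_nonzero)
  ultimately show False by simp
qed

text \<open>This turns bounded valuations at finitely many primes into a bound on the size of
  \<open>x\<close>.\<close>

lemma dvd_prod_prime_powers:
  fixes x :: nat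
  assumes "finite P" "x \<noteq> 0" "prime_factors x \<subseteq> P" "\<And>p. p \<in> P \<Longrightarrow> \<not> p ^ e p dvd x"
  shows "x dvd (\<Prod>p\<in>P. p ^ e p)"
proof -
  have "multiplicity p x \<le> e p" if "p \<in> prime_factors x" for p
    using assms(3,4) that multiplicity_dvd' by (meson linear subsetD)
  then have "(\<Prod>p\<in>prime_factors x. p ^ multiplicity p x) dvd (\<Prod>p\<in>P. p ^ e p)"
    using assms(1,3) by (intro prod_dvd_prod_subset2) (auto intro: le_imp_power_dvd)
  then show ?thesis using prime_factorization_nat[of x] assms(2) by simp
qed

theorem infinite_prime_divisors_affine_recurrence:
  assumes rec: "\<And>n. a (Suc n) = f n * a n + u n"
    and f: "residually_periodic f" and u: "residually_periodic u"
    and growth: "\<And>n. n \<ge> N0 \<Longrightarrow> \<bar>f n\<bar> \<ge> \<bar>u n\<bar> + 2" and u0: "\<And>n. u n \<noteq> 0"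
  shows "infinite (prime_divisors_of_seq a)"
proof
  let ?P = "prime_divisors_of_seq a"
  assume fin: "finite ?P"
  have "finite {N. N \<ge> N0 \<and> bad_index a (int p) N}" (is "finite ?B") if "p \<in> ?P" for p
  proof (rule ccontr)
    assume "infinite ?B"
    then obtain N where N: "N \<in> ?B" by (metis equals0I finite.emptyI)
    from \<open>infinite ?B\<close> obtain N' where N': "N' > N" "N' \<in> ?B"
      by (meson finite_nat_set_iff_bounded_le not_le)
    have "int p > 1"
      using that prime_gt_1_nat by (auto simp: prime_divisors_of_seq_def)
    then show False
      using bad_index_unique[of a f u N "int p" "N' - N", OF rec f u] growth u0 N N' by auto
  qed
  then have "finite (\<Union>p\<in>?P. {N. N \<ge> N0 \<and> bad_index a (int p) N})"
    using fin by blast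
  then obtain K where K: "\<forall>N \<in> (\<Union>p\<in>?P. {N. N \<ge> N0 \<and> bad_index a (int p) N}). N < K"
    using finite_nat_set_iff_bounded by auto
  define N where "N = max N0 K"
  have "\<not> bad_index a (int p) N" if "p \<in> ?P" for p
  proof
    assume "bad_index a (int p) N"
    then have "N < K" using K that N_def by (auto simp del: max_less_iff_conj)
    then show False by (simp add: N_def)
  qed
  then have "\<forall>p\<in>?P. \<exists>e T n0. T > 0 \<and> (\<forall>j. N + j * T \<ge> n0 \<longrightarrow> \<not> int p ^ e dvd a (N + j * T))"
    unfolding bad_index_def by blast
  then obtain e T n0 where good: "\<And>p. p \<in> ?P \<Longrightarrow> T p > (0::nat)"
      "\<And>p j. p \<in> ?P \<Longrightarrow> N + j * T p \<ge> n0 p \<Longrightarrow> \<not> int p ^ e p dvd a (N + j * T p)"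
    by metis
  \<comment> \<open>If \<open>a N0\<close> vanishes, the next term is \<open>u N0\<close>, which is
    nonzero.\<close>
  obtain N1 where N1: "N1 \<ge> N0" "a N1 \<noteq> 0"
    using rec[of N0] u0[of N0] that[of N0] that[of "Suc N0"] by (cases "a N0 = 0") auto
  \<comment> \<open>\<open>R\<close> is a common multiple of all \<open>T p\<close>, so
    \<open>n\<close> lies in every good progression; the summands of \<open>j\<close> make
    \<open>n\<close> exceed each \<open>n0 p\<close> and give growth from \<open>N1\<close> enough
    steps to pass \<open>B\<close>.\<close>
  define R B j n where "R = (\<Prod>p\<in>?P. T p)" and "B = (\<Prod>p\<in>?P. p ^ e p)"
    and "j = N1 + B + (\<Sum>p\<in>?P. n0 p)" and "n = N + j * R"
  have "R > 0" unfolding R_def using good(1) by (simp add: prod_pos)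
  then have n_ge: "n \<ge> j" by (simp add: n_def trans_le_add2)
  have "\<bar>a n\<bar> \<ge> int (n - N1) + 1"
    using affine_iter_growth[of N1 u f "a N1" "n - N1"] growth N1 n_ge
    by (auto simp: affine_iter_seq[of a f u, OF rec] j_def)
  then have large: "nat \<bar>a n\<bar> > B" using n_ge by (simp add: j_def)
  have "\<not> p ^ e p dvd nat \<bar>a n\<bar>" if p: "p \<in> ?P" for p
  proof -
    have "R = T p * (\<Prod>q\<in>?P - {p}. T q)"
      unfolding R_def using fin p by (rule prod.remove)
    then have n: "n = N + (j * (\<Prod>q\<in>?P - {p}. T q)) * T p"
      by (simp add: n_def)
    have "n0 p \<le> (\<Sum>p\<in>?P. n0 p)" using fin p by (intro member_le_sum) auto
    then have "n \<ge> n0 p" using n_ge by (simp add: j_def)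
    then have "\<not> int p ^ e p dvd a n" using good(2)[OF p] n by metis
    then show ?thesis by simp
  qed
  moreover have "prime_factors (nat \<bar>a n\<bar>) \<subseteq> ?P"
    by (auto simp: prime_divisors_of_seq_def in_prime_factors_iff)
  ultimately have "nat \<bar>a n\<bar> dvd B"
    unfolding B_def using fin large by (intro dvd_prod_prime_powers) auto
  moreover have "B > 0"
    unfolding B_def by (rule prod_pos) (auto simp: prime_divisors_of_seq_def prime_gt_0_nat)
  ultimately show False using large by (meson dvd_imp_le not_le)
qed

lemma residually_periodic_linear: "residually_periodic (\<lambda>n. x * int (Suc n) + y)"
  unfolding residually_periodic_def
proof (intro allI impI)
  fix m :: int assume "m > 0"
  then show "\<exists>T>0. \<forall>n. [x * int (Suc (n + T)) + y = x * int (Suc n) + y] (mod m)"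
    \<comment> \<open>The modulus itself is a period.\<close>
    by (intro exI[of _ "nat m"]) (auto simp: cong_iff_dvd_diff algebra_simps)
qed

lemma residually_periodic_sign:
  assumes "\<epsilon> \<in> {1, -1}"
  shows "residually_periodic (\<lambda>n. \<epsilon> ^ Suc n * c)"
  unfolding residually_periodic_def using assms by (auto intro!: exI[of _ 2])

theorem theorem13:
  fixes b\<^sub>0 b\<^sub>1 c \<epsilon> :: int and a :: "nat \<Rightarrow> int"
  assumes "b\<^sub>1 \<noteq> 0"
    and "\<epsilon> \<in> {1, -1}"
    and "a 0 = c"
    and "\<And>n. n > 0 \<Longrightarrow> a n = (b\<^sub>1 * int n + b\<^sub>0) * a (n - 1) + \<epsilon> ^ n * c"
  shows "infinite (prime_divisors_of_seq a)"
proof (cases "c = 0")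
  case True
  \<comment> \<open>Every prime divides \<open>a 0 = 0\<close>.\<close>
  then have "prime_divisors_of_seq a = {p. prime p}"
    using assms(3) by (auto simp: prime_divisors_of_seq_def intro: exI[of _ 0])
  then show ?thesis using primes_infinite by simp
next
  case False
  let ?f = "\<lambda>n. b\<^sub>1 * int (Suc n) + b\<^sub>0" and ?u = "\<lambda>n. \<epsilon> ^ Suc n * c"
  have eps: "\<bar>\<epsilon> ^ k\<bar> = 1" for k
    using assms(2) by (auto simp: power_abs)
  show ?thesis
  \<comment> \<open>The threshold works because |\<open>?f n\<close>| \<ge> n + 1 -
    |\<open>b\<^sub>0\<close>| and |\<open>?u n\<close>| = |c|.\<close>
  proof (rule infinite_prime_divisors_affine_recurrence
      [of a ?f ?u "nat (\<bar>b\<^sub>0\<bar> + \<bar>c\<bar> + 2)"])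
    show "a (Suc n) = ?f n * a n + ?u n" for n
      using assms(4)[of "Suc n"] by simp
    show "residually_periodic ?f" by (rule residually_periodic_linear)
    show "residually_periodic ?u" using assms(2) by (rule residually_periodic_sign)
    show "?u n \<noteq> 0" for n using False assms(2) by auto
    show "\<bar>?f n\<bar> \<ge> \<bar>?u n\<bar> + 2" if "n \<ge> nat (\<bar>b\<^sub>0\<bar> + \<bar>c\<bar> + 2)" for n
    proof -
      have "\<bar>?u n\<bar> = \<bar>c\<bar>" by (simp only: abs_mult eps)
      moreover have "1 * int (Suc n) \<le> \<bar>b\<^sub>1\<bar> * int (Suc n)"
        using assms(1) by (intro mult_right_mono) auto
      then have "int (Suc n) \<le> \<bar>b\<^sub>1 * int (Suc n)\<bar>" by (simp add: abs_mult)
      ultimately show ?thesis using that by linarith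
    qed
  qed
qed

end
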